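(* Let $X$ be a linear order with $X^3\cong X$. (1) If $X$ has no endpoints, then $X$ admits a $\mathbb{Z}$-cover. (2) If $X$ has a left endpoint but no right endpoint, then $X$ admits a $\{\mathbb{Z},\omega\}$-cover. (3) If $X$ has a right endpoint but no left endpoint, then $X$ admits a $\{\mathbb{Z},\omega^*\}$-cover.
   Context: $X^3$ is the lexicographic cube. An interval is a convex subset. A $\mathbb{Z}$-interval has no minimum and no maximum and has coinitiality and cofinality $\omega$; an $\omega$-interval has a minimum and cofinality $\omega$; an $\omega^*$-interval has a maximum and coinitiality $\omega$. A cover of $X$ is a collection of pairwise disjoint intervals whose union is $X$; a $\mathbb{Z}$-cover consists of $\mathbb{Z}$-intervals, a $\{\mathbb{Z},\omega\}$-cover of $\mathbb{Z}$-intervals and $\omega$-intervals, a $\{\mathbb{Z},\omega^*\}$-cover of $\mathbb{Z}$-intervals and $\omega^*$-intervals. *)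

theory Defs
  imports Main "HOL-Library.Product_Lexorder"
begin

text \<open>
  A linear order is a set \<open>X\<close> in a type of class \<open>linorder\<close>, with the induced order. This
  covers every linear order: a nonempty one as \<open>UNIV\<close> of its type, and the empty one as \<open>{}\<close>.
  Products of types carry the lexicographic order of \<^theory>\<open>HOL-Library.Product_Lexorder\<close>,
  so \<open>X \<times> X \<times> X\<close> is the lexicographic cube.
\<close>

definition order_isomorphic :: "'a::linorder set \<Rightarrow> 'b::linorder set \<Rightarrow> bool" where
  "order_isomorphic A B \<longleftrightarrow> (\<exists>f. bij_betw f A B \<and> strict_mono_on A f)"

definition cube :: "'a set \<Rightarrow> ('a \<times> 'a \<times> 'a) set" where
  "cube X = X \<times> X \<times> X"

definition has_minimum :: "'a::linorder set \<Rightarrow> bool" where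
  "has_minimum A \<longleftrightarrow> (\<exists>m\<in>A. \<forall>x\<in>A. m \<le> x)"

definition has_maximum :: "'a::linorder set \<Rightarrow> bool" where
  "has_maximum A \<longleftrightarrow> (\<exists>m\<in>A. \<forall>x\<in>A. x \<le> m)"

definition interval_of :: "'a::linorder set \<Rightarrow> 'a set \<Rightarrow> bool" where
  "interval_of X I \<longleftrightarrow> I \<subseteq> X \<and> (\<forall>x\<in>I. \<forall>z\<in>I. \<forall>y\<in>X. x < y \<and> y < z \<longrightarrow> y \<in> I)"

text \<open>
  Cofinality \<open>\<omega>\<close>: the order type \<open>\<omega>\<close> embeds cofinally. Such an order has no maximum, so no
  finite order type embeds cofinally and \<open>\<omega>\<close> is indeed the least one. Dually for coinitiality.
\<close>

definition cofinality_omega :: "'a::linorder set \<Rightarrow> bool" where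
  "cofinality_omega A \<longleftrightarrow>
     (\<exists>s :: nat \<Rightarrow> 'a. strict_mono s \<and> range s \<subseteq> A \<and> (\<forall>x\<in>A. \<exists>n. x \<le> s n))"

definition coinitiality_omega :: "'a::linorder set \<Rightarrow> bool" where
  "coinitiality_omega A \<longleftrightarrow>
     (\<exists>s :: nat \<Rightarrow> 'a. (\<forall>m n. m < n \<longrightarrow> s n < s m) \<and> range s \<subseteq> A \<and> (\<forall>x\<in>A. \<exists>n. s n \<le> x))"

definition Z_interval :: "'a::linorder set \<Rightarrow> 'a set \<Rightarrow> bool" where
  "Z_interval X I \<longleftrightarrow> interval_of X I \<and> \<not> has_minimum I \<and> \<not> has_maximum I \<and>
     coinitiality_omega I \<and> cofinality_omega I"

definition omega_interval :: "'a::linorder set \<Rightarrow> 'a set \<Rightarrow> bool" where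
  "omega_interval X I \<longleftrightarrow> interval_of X I \<and> has_minimum I \<and> cofinality_omega I"

definition omega_star_interval :: "'a::linorder set \<Rightarrow> 'a set \<Rightarrow> bool" where
  "omega_star_interval X I \<longleftrightarrow> interval_of X I \<and> has_maximum I \<and> coinitiality_omega I"

definition cover :: "'a::linorder set \<Rightarrow> 'a set set \<Rightarrow> bool" where
  "cover X C \<longleftrightarrow> (\<forall>I\<in>C. interval_of X I) \<and> pairwise disjnt C \<and> \<Union>C = X"

definition Z_cover :: "'a::linorder set \<Rightarrow> 'a set set \<Rightarrow> bool" where
  "Z_cover X C \<longleftrightarrow> cover X C \<and> (\<forall>I\<in>C. Z_interval X I)"

definition Z_omega_cover :: "'a::linorder set \<Rightarrow> 'a set set \<Rightarrow> bool" where
  "Z_omega_cover X C \<longleftrightarrow> cover X C \<and> (\<forall>I\<in>C. Z_interval X I \<or> omega_interval X I)"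

definition Z_omega_star_cover :: "'a::linorder set \<Rightarrow> 'a set set \<Rightarrow> bool" where
  "Z_omega_star_cover X C \<longleftrightarrow> cover X C \<and> (\<forall>I\<in>C. Z_interval X I \<or> omega_star_interval X I)"

end

theory Submission
  imports Defs
begin

text \<open>
  Reading \<open>X \<cong> X \<times> X\<^sup>2\<close> as a projection gives a monotone surjection \<open>p\<close> of \<open>X\<close> onto itself, all
  of whose fibres are copies of \<open>X\<^sup>2\<close>. Call \<open>x\<close> and \<open>y\<close> equivalent if \<open>p\<^sup>n x = p\<^sup>n y\<close> for some \<open>n\<close>.
  Each class is convex and is the union of the increasing sequence of the fibres of
  \<open>p, p\<^sup>2, p\<^sup>3, \<dots>\<close> through one of its points. If \<open>X\<close> has no maximum, these fibres grow strictly to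
  the right at every step, so the class has cofinality \<open>\<omega>\<close>. If \<open>X\<close> has a maximum, so does every
  fibre, and either they grow to the right infinitely often, or the class has a maximum.
  The same holds on the left, and the classes form the required cover.
\<close>

section \<open>Eventual equality under the iterates of a map\<close>

definition iter_class :: "('a \<Rightarrow> 'a) \<Rightarrow> 'a set \<Rightarrow> 'a \<Rightarrow> 'a set" where
  "iter_class p X x = {y \<in> X. \<exists>n. (p ^^ n) y = (p ^^ n) x}"

lemma funpow_eq_mono:
  fixes p :: "'a \<Rightarrow> 'a"
  assumes "(p ^^ m) x = (p ^^ m) y" and "m \<le> n"
  shows "(p ^^ n) x = (p ^^ n) y"
proof -
  have "p ^^ n = (p ^^ (n - m)) \<circ> (p ^^ m)"
    using assms(2) by (metis funpow_add le_add_diff_inverse2)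
  then show ?thesis using assms(1) by simp
qed

lemma funpow_image_eq:
  assumes "p ` X = X"
  shows "(p ^^ n) ` X = X"
proof (induction n)
  case (Suc n)
  then show ?case using assms by (metis funpow.simps(2) image_comp)
qed simp

lemma iter_class_refl: "x \<in> X \<Longrightarrow> x \<in> iter_class p X x"
  by (auto simp: iter_class_def)

text \<open>Agreement persists under further iteration, so two agreements at times \<open>k\<close>
  and \<open>n\<close> both hold at time \<open>max k n\<close>; this gives transitivity.\<close>

lemma iter_class_eq:
  assumes "y \<in> iter_class p X x"
  shows "iter_class p X y = iter_class p X x"
proof -
  obtain n where n: "(p ^^ n) y = (p ^^ n) x"
    using assms by (auto simp: iter_class_def)
  have "(\<exists>k. (p ^^ k) z = (p ^^ k) y) \<longleftrightarrow> (\<exists>k. (p ^^ k) z = (p ^^ k) x)" for z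
  proof -
    have "(p ^^ max k n) z = (p ^^ max k n) x" if "(p ^^ k) z = (p ^^ k) y" for k
      using funpow_eq_mono[OF that, of "max k n"] funpow_eq_mono[OF n, of "max k n"] by simp
    moreover have "(p ^^ max k n) z = (p ^^ max k n) y" if "(p ^^ k) z = (p ^^ k) x" for k
      using funpow_eq_mono[OF that, of "max k n"] funpow_eq_mono[OF n, of "max k n"] by simp
    ultimately show ?thesis by blast
  qed
  then show ?thesis by (auto simp: iter_class_def)
qed

section \<open>Cofinal sequences and greatest elements of classes\<close>

context linorder
begin

text \<open>\<open>t\<close> need not be increasing. As \<open>cof\<close> is strict, any two points
  of \<open>C\<close> have a common strict upper bound in \<open>C\<close>, so each next term can be
  chosen above both \<open>s n\<close> and \<open>t n\<close>. The conclusion spells out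
  \<open>cofinality_omega\<close> so that in the dual order it reads as
  \<open>coinitiality_omega\<close>.\<close>

lemma strictly_increasing_cofinal_sequence:
  fixes t :: "nat \<Rightarrow> 'a"
  assumes "range t \<subseteq> C" and cof: "\<And>y. y \<in> C \<Longrightarrow> \<exists>k. y < t k"
  shows "\<exists>s :: nat \<Rightarrow> 'a. (\<forall>m n. m < n \<longrightarrow> s m < s n) \<and> range s \<subseteq> C \<and> (\<forall>x\<in>C. \<exists>n. x \<le> s n)"
proof -
  have "\<exists>z. z \<in> C \<and> y < z \<and> t n < z" if "y \<in> C" for y n
    using that cof[of y] cof[of "t n"] assms(1)
    by (metis dual_order.strict_trans linorder_cases rangeI subset_iff)
  then obtain s where s: "\<And>n. s n \<in> C" "\<And>n. s n < s (Suc n)" "\<And>n. t n < s (Suc n)"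
    using dependent_nat_choice[of "\<lambda>_ y. y \<in> C" "\<lambda>n y z. y < z \<and> t n < z"] assms(1)
    by (metis rangeI subset_iff)
  have "s m < s n" if "m < n" for m n
    using lift_Suc_mono_less[of s] s(2) that by blast
  moreover have "\<exists>n. x \<le> s n" if "x \<in> C" for x
    using cof[OF that] s(3) by (meson less_imp_le less_trans)
  ultimately show ?thesis using s(1) by blast
qed

text \<open>\<open>refl\<close> is monotonicity of \<open>p\<close> in contrapositive form, and this
  form passes to iterates.\<close>

lemma funpow_less_reflect:
  assumes maps: "p ` X \<subseteq> X" and refl: "\<And>x y. x \<in> X \<Longrightarrow> y \<in> X \<Longrightarrow> p x < p y \<Longrightarrow> x < y"
    and "x \<in> X" "y \<in> X" "(p ^^ n) x < (p ^^ n) y"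
  shows "x < y"
  using assms(3-)
proof (induction n arbitrary: x y)
  case (Suc n)
  then have "p x < p y"
    using maps by (auto simp: funpow_Suc_right simp del: funpow.simps)
  then show ?case using refl Suc.prems by blast
qed simp

text \<open>Choose one witness of \<open>grow\<close> for each \<open>n\<close>. A point of the
  class that agrees with \<open>x\<close> at time \<open>n\<close> lies below the
  \<open>n\<close>-th witness, because the \<open>n\<close>-th iterate reflects the order.\<close>

lemma iter_class_cofinal:
  assumes maps: "p ` X \<subseteq> X" and refl: "\<And>x y. x \<in> X \<Longrightarrow> y \<in> X \<Longrightarrow> p x < p y \<Longrightarrow> x < y"
    and x: "x \<in> X"
    and grow: "\<And>n. \<exists>z \<in> iter_class p X x. (p ^^ n) x < (p ^^ n) z"
  shows "\<exists>s :: nat \<Rightarrow> 'a. (\<forall>m n. m < n \<longrightarrow> s m < s n) \<and> range s \<subseteq> iter_class p X x \<and>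
           (\<forall>y \<in> iter_class p X x. \<exists>n. y \<le> s n)"
proof -
  obtain t where t: "\<And>n. t n \<in> iter_class p X x" "\<And>n. (p ^^ n) x < (p ^^ n) (t n)"
    using grow by metis
  show ?thesis
  proof (rule strictly_increasing_cofinal_sequence[of t])
    fix y assume "y \<in> iter_class p X x"
    then obtain n where "y \<in> X" "(p ^^ n) y = (p ^^ n) x"
      by (auto simp: iter_class_def)
    then have "y < t n"
      using funpow_less_reflect[OF maps refl, of y "t n" n] t[of n]
      by (auto simp: iter_class_def)
    then show "\<exists>k. y < t k" ..
  qed (use t in auto)
qed

text \<open>Move up from \<open>(p ^^ n) x\<close> inside its fibre of \<open>p\<close>, then lift
  the new point along the surjection \<open>p ^^ n\<close>. The lift agrees with \<open>x\<close>
  one step later, hence stays in the class.\<close>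

lemma iter_class_cofinal_if_fibres_unbounded:
  assumes surj: "p ` X = X" and refl: "\<And>x y. x \<in> X \<Longrightarrow> y \<in> X \<Longrightarrow> p x < p y \<Longrightarrow> x < y"
    and x: "x \<in> X"
    and fibre: "\<And>c. c \<in> X \<Longrightarrow> \<exists>d\<in>X. p d = p c \<and> c < d"
  shows "\<exists>s :: nat \<Rightarrow> 'a. (\<forall>m n. m < n \<longrightarrow> s m < s n) \<and> range s \<subseteq> iter_class p X x \<and>
           (\<forall>y \<in> iter_class p X x. \<exists>n. y \<le> s n)"
proof (rule iter_class_cofinal[OF _ refl x])
  fix n
  have "(p ^^ n) x \<in> X" using x funpow_image_eq[OF surj] by blast
  then obtain d where d: "d \<in> X" "p d = p ((p ^^ n) x)" "(p ^^ n) x < d"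
    using fibre by blast
  then have "d \<in> (p ^^ n) ` X" by (simp add: funpow_image_eq[OF surj])
  then obtain z where z: "z \<in> X" "(p ^^ n) z = d" by auto
  then have "(p ^^ Suc n) z = (p ^^ Suc n) x" using d by simp
  then show "\<exists>z \<in> iter_class p X x. (p ^^ n) x < (p ^^ n) z"
    using z d unfolding iter_class_def by blast
qed (use surj in auto)

text \<open>Lift \<open>c\<close> greedily, taking the greatest preimage at every step. The bound
  concerns all points mapped to \<open>c\<close> or below, since in the induction
  \<open>(p ^^ n) z\<close> is only known to be at most \<open>d\<close>.\<close>

lemma funpow_fibre_greatest:
  assumes surj: "p ` X = X" and refl: "\<And>x y. x \<in> X \<Longrightarrow> y \<in> X \<Longrightarrow> p x < p y \<Longrightarrow> x < y"
    and fibre: "\<And>d. d \<in> X \<Longrightarrow> \<exists>m\<in>X. p m = d \<and> (\<forall>z\<in>X. p z = d \<longrightarrow> z \<le> m)"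
    and "c \<in> X"
  shows "\<exists>m\<in>X. (p ^^ n) m = c \<and> (\<forall>z\<in>X. (p ^^ n) z \<le> c \<longrightarrow> z \<le> m)"
  using \<open>c \<in> X\<close>
proof (induction n arbitrary: c)
  case (Suc n)
  obtain d where d: "d \<in> X" "p d = c" "\<forall>z\<in>X. p z = c \<longrightarrow> z \<le> d"
    using fibre Suc.prems by blast
  then obtain m where m: "m \<in> X" "(p ^^ n) m = d" "\<forall>z\<in>X. (p ^^ n) z \<le> d \<longrightarrow> z \<le> m"
    using Suc.IH by blast
  have "z \<le> m" if z: "z \<in> X" "(p ^^ Suc n) z \<le> c" for z
  proof -
    have zX: "(p ^^ n) z \<in> X" using z(1) funpow_image_eq[OF surj] by blast
    have "(p ^^ n) z \<le> d"
    proof (cases "p ((p ^^ n) z) = c")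
      case False
      then have "p ((p ^^ n) z) < p d" using z d by simp
      then show ?thesis using refl zX d(1) by (simp add: less_imp_le)
    qed (use d zX in blast)
    then show ?thesis using m z by blast
  qed
  then show ?case using m d by auto
qed auto

text \<open>If growth fails at some \<open>n\<close>, the whole class is mapped by
  \<open>p ^^ n\<close> to \<open>(p ^^ n) x\<close> or below, so the greatest point of that fibre
  is the maximum of the class.\<close>

lemma iter_class_cofinal_or_greatest:
  assumes surj: "p ` X = X" and refl: "\<And>x y. x \<in> X \<Longrightarrow> y \<in> X \<Longrightarrow> p x < p y \<Longrightarrow> x < y"
    and x: "x \<in> X"
    and fibre: "\<And>d. d \<in> X \<Longrightarrow> \<exists>m\<in>X. p m = d \<and> (\<forall>z\<in>X. p z = d \<longrightarrow> z \<le> m)"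
  shows "(\<exists>s :: nat \<Rightarrow> 'a. (\<forall>m n. m < n \<longrightarrow> s m < s n) \<and> range s \<subseteq> iter_class p X x \<and>
            (\<forall>y \<in> iter_class p X x. \<exists>n. y \<le> s n)) \<or>
         (\<exists>m \<in> iter_class p X x. \<forall>y \<in> iter_class p X x. y \<le> m)"
proof (cases "\<forall>n. \<exists>z \<in> iter_class p X x. (p ^^ n) x < (p ^^ n) z")
  case True
  then show ?thesis
    using iter_class_cofinal[of p X x] surj refl x by blast
next
  case False
  then obtain n where n: "\<And>z. z \<in> iter_class p X x \<Longrightarrow> (p ^^ n) z \<le> (p ^^ n) x"
    by (meson not_less)
  have "(p ^^ n) x \<in> X" using x funpow_image_eq[OF surj] by blast
  from funpow_fibre_greatest[OF surj refl fibre this, of n]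
  obtain m where m: "m \<in> X" "(p ^^ n) m = (p ^^ n) x"
      "\<forall>z\<in>X. (p ^^ n) z \<le> (p ^^ n) x \<longrightarrow> z \<le> m"
    by blast
  then have "m \<in> iter_class p X x" by (auto simp: iter_class_def)
  moreover have "y \<le> m" if "y \<in> iter_class p X x" for y
    using n[OF that] m(3) that by (auto simp: iter_class_def)
  ultimately show ?thesis by blast
qed

end

section \<open>Missing endpoints, convexity and the cover by classes\<close>

lemma cofinality_omega_no_maximum:
  assumes "cofinality_omega A"
  shows "\<not> has_maximum A"
proof
  assume "has_maximum A"
  then obtain m where m: "m \<in> A" "\<And>x. x \<in> A \<Longrightarrow> x \<le> m"
    by (auto simp: has_maximum_def)
  obtain s :: "nat \<Rightarrow> 'a" where s: "\<forall>m n. m < n \<longrightarrow> s m < s n" "range s \<subseteq> A"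
      "\<forall>x\<in>A. \<exists>n. x \<le> s n"
    using assms unfolding cofinality_omega_def strict_mono_def by (elim exE conjE)
  obtain n where "m \<le> s n" using s(3) m(1) by blast
  moreover have "s (Suc n) \<le> m" using s(2) m(2) by blast
  ultimately show False using s(1) by (meson lessI not_le order_trans)
qed

lemma coinitiality_omega_no_minimum:
  assumes "coinitiality_omega A"
  shows "\<not> has_minimum A"
proof
  assume "has_minimum A"
  then obtain m where m: "m \<in> A" "\<And>x. x \<in> A \<Longrightarrow> m \<le> x"
    by (auto simp: has_minimum_def)
  obtain s :: "nat \<Rightarrow> 'a" where s: "\<forall>m n. m < n \<longrightarrow> s n < s m" "range s \<subseteq> A"
      "\<forall>x\<in>A. \<exists>n. s n \<le> x"
    using assms unfolding coinitiality_omega_def by (elim exE conjE)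
  obtain n where "s n \<le> m" using s(3) m(1) by blast
  moreover have "m \<le> s (Suc n)" using s(2) m(2) by blast
  ultimately show False using s(1) by (meson lessI not_le order_trans)
qed

lemma iter_class_interval:
  fixes X :: "'a::linorder set"
  assumes maps: "p ` X \<subseteq> X" and refl: "\<And>x y. x \<in> X \<Longrightarrow> y \<in> X \<Longrightarrow> p x < p y \<Longrightarrow> x < y"
  shows "interval_of X (iter_class p X x)"
  unfolding interval_of_def
proof (intro conjI ballI impI)
  show "iter_class p X x \<subseteq> X" by (auto simp: iter_class_def)
next
  fix a b y
  assume a: "a \<in> iter_class p X x" and b: "b \<in> iter_class p X x"
    and y: "y \<in> X" "a < y \<and> y < b"
  have "b \<in> iter_class p X a" using a b iter_class_eq by metis
  then obtain n where n: "(p ^^ n) b = (p ^^ n) a"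
    by (auto simp: iter_class_def)
  have "a \<in> X" "b \<in> X" using a b by (auto simp: iter_class_def)
  \<comment> \<open>By reflection \<open>(p ^^ n) y\<close> is squeezed between the equal values at
    \<open>a\<close> and \<open>b\<close>.\<close>
  then have "\<not> (p ^^ n) y < (p ^^ n) a" "\<not> (p ^^ n) b < (p ^^ n) y"
    using funpow_less_reflect[OF maps refl, of y a n] funpow_less_reflect[OF maps refl, of b y n] y
    by auto
  then have "(p ^^ n) y = (p ^^ n) a" using n by simp
  then have "y \<in> iter_class p X a" using y by (auto simp: iter_class_def)
  then show "y \<in> iter_class p X x" using iter_class_eq[OF a] by simp
qed

lemma iter_class_cover:
  fixes X :: "'a::linorder set"
  assumes maps: "p ` X \<subseteq> X" and refl: "\<And>x y. x \<in> X \<Longrightarrow> y \<in> X \<Longrightarrow> p x < p y \<Longrightarrow> x < y"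
  shows "cover X (iter_class p X ` X)"
  unfolding cover_def
proof (intro conjI)
  show "\<forall>I\<in>iter_class p X ` X. interval_of X I"
    using iter_class_interval[OF maps refl] by blast
  show "pairwise disjnt (iter_class p X ` X)"
    unfolding pairwise_def disjnt_iff using iter_class_eq by (metis imageE)
  show "\<Union> (iter_class p X ` X) = X"
    using iter_class_refl by (fastforce simp: iter_class_def)
qed

section \<open>The projection obtained from the cube and the endpoints of its fibres\<close>

lemma cube_projection:
  fixes X :: "'a::linorder set"
  assumes "order_isomorphic (cube X) X"
  obtains p where "p ` X = X" and "\<And>x y. x \<in> X \<Longrightarrow> y \<in> X \<Longrightarrow> p x < p y \<Longrightarrow> x < y"
    and "\<And>c. \<not> has_maximum X \<Longrightarrow> c \<in> X \<Longrightarrow> \<exists>d\<in>X. p d = p c \<and> c < d"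
    and "\<And>c. \<not> has_minimum X \<Longrightarrow> c \<in> X \<Longrightarrow> \<exists>d\<in>X. p d = p c \<and> d < c"
    and "\<And>d. has_maximum X \<Longrightarrow> d \<in> X \<Longrightarrow> \<exists>m\<in>X. p m = d \<and> (\<forall>z\<in>X. p z = d \<longrightarrow> z \<le> m)"
    and "\<And>d. has_minimum X \<Longrightarrow> d \<in> X \<Longrightarrow> \<exists>m\<in>X. p m = d \<and> (\<forall>z\<in>X. p z = d \<longrightarrow> m \<le> z)"
proof -
  obtain f where bij: "bij_betw f (cube X) X" and mono: "strict_mono_on (cube X) f"
    using assms by (auto simp: order_isomorphic_def)
  define h where "h = inv_into (cube X) f"
  \<comment> \<open>\<open>p\<close> is the first coordinate of the cube, carried over to
    \<open>X\<close> by \<open>f\<close>.\<close>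
  define p where "p x = fst (h x)" for x
  have f_less: "f u < f v \<longleftrightarrow> u < v" if "u \<in> cube X" "v \<in> cube X" for u v
    using strict_mono_on_less[OF mono that] .
  have f_le: "f u \<le> f v \<longleftrightarrow> u \<le> v" if "u \<in> cube X" "v \<in> cube X" for u v
    using strict_mono_on_less_eq[OF mono that] .
  have pf: "p (f (a, b, c)) = a" and fX: "f (a, b, c) \<in> X"
    if "a \<in> X" "b \<in> X" "c \<in> X" for a b c
    using that bij bij_betw_inv_into_left[OF bij, of "(a, b, c)"]
    by (auto simp: p_def h_def cube_def bij_betw_def)
  have ex: "\<exists>b\<in>X. \<exists>c\<in>X. x = f (p x, b, c) \<and> p x \<in> X" if "x \<in> X" for x
  proof -
    have "h x \<in> cube X" "f (h x) = x"
      using that bij bij_betw_inv_into_right[OF bij, of x] inv_into_into[of x f "cube X"]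
      by (auto simp: h_def bij_betw_def)
    then show ?thesis
      by (cases "h x") (auto simp: p_def cube_def)
  qed
  show thesis
  proof (rule that[of p])
    \<comment> \<open>The diagonal triple supplies the other two coordinates without a base point,
      so an empty \<open>X\<close> is no special case.\<close>
    have "a \<in> p ` X" if "a \<in> X" for a
      using pf[of a a a] fX[of a a a] that by (metis imageI)
    then show "p ` X = X" using ex by blast
  next
    fix x y assume xy: "x \<in> X" "y \<in> X" "p x < p y"
    obtain a b where a: "a \<in> X" "b \<in> X" "x = f (p x, a, b)" "p x \<in> X" using ex xy by blast
    obtain c d where c: "c \<in> X" "d \<in> X" "y = f (p y, c, d)" "p y \<in> X" using ex xy by blast
    have "f (p x, a, b) < f (p y, c, d)"
      using a c xy by (subst f_less) (auto simp: cube_def)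
    then show "x < y" using a c by simp
  next
    fix c assume "\<not> has_maximum X" "c \<in> X"
    obtain b e where c: "b \<in> X" "e \<in> X" "c = f (p c, b, e)" "p c \<in> X" using ex[OF \<open>c \<in> X\<close>] by blast
    \<comment> \<open>Raising only the last coordinate moves right without leaving the
      fibre.\<close>
    obtain e' where e': "e' \<in> X" "e < e'"
      using \<open>\<not> has_maximum X\<close> c by (meson has_maximum_def not_le)
    have "f (p c, b, e) < f (p c, b, e')"
      using c e' by (subst f_less) (auto simp: cube_def)
    then show "\<exists>d\<in>X. p d = p c \<and> c < d"
      using pf fX c e' by metis
  next
    fix c assume "\<not> has_minimum X" "c \<in> X"
    obtain b e where c: "b \<in> X" "e \<in> X" "c = f (p c, b, e)" "p c \<in> X" using ex[OF \<open>c \<in> X\<close>] by blast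
    obtain e' where e': "e' \<in> X" "e' < e"
      using \<open>\<not> has_minimum X\<close> c by (meson has_minimum_def not_le)
    have "f (p c, b, e') < f (p c, b, e)"
      using c e' by (subst f_less) (auto simp: cube_def)
    then show "\<exists>d\<in>X. p d = p c \<and> d < c"
      using pf fX c e' by metis
  next
    fix d assume "has_maximum X" "d \<in> X"
    then obtain m where m: "m \<in> X" "\<forall>x\<in>X. x \<le> m" by (auto simp: has_maximum_def)
    \<comment> \<open>\<open>(d, m, m)\<close> is the lexicographically greatest triple with first
      coordinate \<open>d\<close>.\<close>
    have "z \<le> f (d, m, m)" if z: "z \<in> X" "p z = d" for z
    proof -
      obtain b e where be: "b \<in> X" "e \<in> X" "z = f (d, b, e)" using ex z by blast
      have "f (d, b, e) \<le> f (d, m, m)"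
        using be m \<open>d \<in> X\<close> by (subst f_le) (auto simp: cube_def less_le)
      then show ?thesis using be by simp
    qed
    then show "\<exists>m\<in>X. p m = d \<and> (\<forall>z\<in>X. p z = d \<longrightarrow> z \<le> m)"
      using pf fX m \<open>d \<in> X\<close> by metis
  next
    fix d assume "has_minimum X" "d \<in> X"
    then obtain m where m: "m \<in> X" "\<forall>x\<in>X. m \<le> x" by (auto simp: has_minimum_def)
    have "f (d, m, m) \<le> z" if z: "z \<in> X" "p z = d" for z
    proof -
      obtain b e where be: "b \<in> X" "e \<in> X" "z = f (d, b, e)" using ex z by blast
      have "f (d, m, m) \<le> f (d, b, e)"
        using be m \<open>d \<in> X\<close> by (subst f_le) (auto simp: cube_def less_le)
      then show ?thesis using be by simp
    qed
    then show "\<exists>m\<in>X. p m = d \<and> (\<forall>z\<in>X. p z = d \<longrightarrow> m \<le> z)"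
      using pf fX m \<open>d \<in> X\<close> by metis
  qed
qed

section \<open>The covers in the three endpoint cases\<close>

theorem theorem4p6:
  fixes X :: "'a::linorder set"
  assumes "order_isomorphic (cube X) X"
  shows "(\<not> has_minimum X \<and> \<not> has_maximum X \<longrightarrow> (\<exists>C. Z_cover X C)) \<and>
         (has_minimum X \<and> \<not> has_maximum X \<longrightarrow> (\<exists>C. Z_omega_cover X C)) \<and>
         (has_maximum X \<and> \<not> has_minimum X \<longrightarrow> (\<exists>C. Z_omega_star_cover X C))"
proof -
  obtain p where surj: "p ` X = X" and refl: "\<And>x y. x \<in> X \<Longrightarrow> y \<in> X \<Longrightarrow> p x < p y \<Longrightarrow> x < y"
    and no_max: "\<And>c. \<not> has_maximum X \<Longrightarrow> c \<in> X \<Longrightarrow> \<exists>d\<in>X. p d = p c \<and> c < d"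
    and no_min: "\<And>c. \<not> has_minimum X \<Longrightarrow> c \<in> X \<Longrightarrow> \<exists>d\<in>X. p d = p c \<and> d < c"
    and max: "\<And>d. has_maximum X \<Longrightarrow> d \<in> X \<Longrightarrow> \<exists>m\<in>X. p m = d \<and> (\<forall>z\<in>X. p z = d \<longrightarrow> z \<le> m)"
    and min: "\<And>d. has_minimum X \<Longrightarrow> d \<in> X \<Longrightarrow> \<exists>m\<in>X. p m = d \<and> (\<forall>z\<in>X. p z = d \<longrightarrow> m \<le> z)"
    using cube_projection[OF assms] by blast
  let ?I = "iter_class p X"
  have maps: "p ` X \<subseteq> X" using surj by simp
  have cover: "cover X (?I ` X)" and interval: "interval_of X (?I x)" for x
    using iter_class_cover[OF maps refl] iter_class_interval[OF maps refl] by auto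
  have cof: "cofinality_omega (?I x)" if "\<not> has_maximum X" "x \<in> X" for x
    unfolding cofinality_omega_def strict_mono_def
    by (rule iter_class_cofinal_if_fibres_unbounded[OF surj refl that(2) no_max[OF that(1)]])
  \<comment> \<open>The leftward statement is the rightward one in the dual order;
    \<open>refl\<close> is self-dual up to exchanging its two points.\<close>
  have coin: "coinitiality_omega (?I x)" if "\<not> has_minimum X" "x \<in> X" for x
    unfolding coinitiality_omega_def
    by (rule linorder.iter_class_cofinal_if_fibres_unbounded
          [OF dual_linorder surj refl that(2) no_min[OF that(1)]])
  have cof_or_max: "cofinality_omega (?I x) \<or> has_maximum (?I x)" if "has_maximum X" "x \<in> X" for x
    unfolding cofinality_omega_def strict_mono_def has_maximum_def
    by (rule iter_class_cofinal_or_greatest[OF surj refl that(2) max[OF that(1)]])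
  have coin_or_min: "coinitiality_omega (?I x) \<or> has_minimum (?I x)" if "has_minimum X" "x \<in> X" for x
    unfolding coinitiality_omega_def has_minimum_def
    by (rule linorder.iter_class_cofinal_or_greatest
          [OF dual_linorder surj refl that(2) min[OF that(1)]])
  have Z: "Z_interval X (?I x)" if "cofinality_omega (?I x)" "coinitiality_omega (?I x)" for x
    using that interval cofinality_omega_no_maximum coinitiality_omega_no_minimum
    by (auto simp: Z_interval_def)
  have "Z_cover X (?I ` X)" if "\<not> has_minimum X" "\<not> has_maximum X"
    using that cover Z cof coin by (auto simp: Z_cover_def)
  \<comment> \<open>Every class has cofinality \<omega>. On the left it has either coinitiality
    \<omega>, giving a Z-interval, or a minimum, giving an \<omega>-interval.\<close>
  moreover have "Z_omega_cover X (?I ` X)" if "has_minimum X" "\<not> has_maximum X"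
    using that cover interval Z cof coin_or_min by (auto simp: Z_omega_cover_def omega_interval_def)
  moreover have "Z_omega_star_cover X (?I ` X)" if "has_maximum X" "\<not> has_minimum X"
    using that cover interval Z coin cof_or_max
    by (auto simp: Z_omega_star_cover_def omega_star_interval_def)
  ultimately show ?thesis by blast
qed

end
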